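(* Let $\mathcal{C}$ be a locally small, symmetric (relaxed) monoidal closed, well-powered category which is small-complete and has a small cogenerating family. Then $\mathcal{C}$ is small-cocomplete.
   Context: Conventions. "Relaxed" monoidal means that the associativity and unit constraints are natural isomorphisms satisfying the usual coherence axioms, not necessarily identities (i.e. not necessarily strict). A symmetric monoidal category $(\mathcal{C},\otimes,I)$ is closed if for each object $Y$ the functor $X\mapsto X\otimes Y$ has a right adjoint, denoted $Z\mapsto Z^Y$. The unit $I$ is not assumed to be terminal. Small-complete (resp. small-cocomplete) means that every diagram $d:\mathcal{I}\to\mathcal{C}$ with $\mathcal{I}$ a small category has a limit (resp. a colimit). Well-powered means that the subobjects of each object form a small set (up to isomorphism of subobjects). A small cogenerating family is a family $(G_s)_{s\in S}$ of objects of $\mathcal{C}$, indexed by a small set $S$, such that for every object $X$ the arrows from $X$ to the objects $G_s$ are jointly monic: if $u,v:Z\to X$ satisfy $\varphi\circ u=\varphi\circ v$ for all $s\in S$ and all $\varphi:X\to G_s$, then $u=v$. *)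

theory Defs
  imports Main
begin

unbundle cardinal_syntax

text \<open>
  A universe is given by an infinite regular strong limit cardinal \<open>\<kappa>\<close>, and a set (of any type)
  is small if it has fewer than \<open>\<kappa>\<close> elements. Nonempty Grothendieck universes have exactly such
  cardinals; \<open>\<kappa>\<close> is \<open>\<omega>\<close> or strongly inaccessible. Uncountability is not required, so that
  there is an instance (with small meaning finite) without assuming an inaccessible cardinal.
  The collections of objects and of arrows of a category may be of any size relative to \<open>\<kappa>\<close>.
\<close>

definition universe_cardinal :: "'k rel \<Rightarrow> bool" where
  "universe_cardinal \<kappa> \<longleftrightarrow> Cinfinite \<kappa> \<and> regularCard \<kappa> \<and>
     (\<forall>A :: 'k set. |A| <o \<kappa> \<longrightarrow> |Pow A| <o \<kappa>)"

definition small :: "'k rel \<Rightarrow> 'b set \<Rightarrow> bool" where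
  "small \<kappa> A \<longleftrightarrow> |A| <o \<kappa>"

text \<open>\<open>g \<cdot> f\<close> is \<open>g\<close> after \<open>f\<close>; it is meaningful only if \<open>tgt f = src g\<close>.\<close>

record ('o, 'a) cat =
  Ob :: "'o set"
  Arr :: "'a set"
  src :: "'a \<Rightarrow> 'o"
  tgt :: "'a \<Rightarrow> 'o"
  ident :: "'o \<Rightarrow> 'a"
  cmp :: "'a \<Rightarrow> 'a \<Rightarrow> 'a"  (infixr "\<cdot>\<index>" 55)

definition hom :: "('o, 'a, 'm) cat_scheme \<Rightarrow> 'o \<Rightarrow> 'o \<Rightarrow> 'a set" where
  "hom C X Y = {f \<in> Arr C. src C f = X \<and> tgt C f = Y}"

locale category =
  fixes C :: "('o, 'a, 'm) cat_scheme" (structure)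
  assumes src_in_Ob: "f \<in> Arr C \<Longrightarrow> src C f \<in> Ob C"
    and tgt_in_Ob: "f \<in> Arr C \<Longrightarrow> tgt C f \<in> Ob C"
    and ident_in_hom: "X \<in> Ob C \<Longrightarrow> ident C X \<in> hom C X X"
    and cmp_in_hom: "\<lbrakk>f \<in> hom C X Y; g \<in> hom C Y Z\<rbrakk> \<Longrightarrow> g \<cdot> f \<in> hom C X Z"
    and cmp_ident_right: "f \<in> hom C X Y \<Longrightarrow> f \<cdot> ident C X = f"
    and cmp_ident_left: "f \<in> hom C X Y \<Longrightarrow> ident C Y \<cdot> f = f"
    and cmp_assoc: "\<lbrakk>f \<in> hom C W X; g \<in> hom C X Y; h \<in> hom C Y Z\<rbrakk>
                      \<Longrightarrow> (h \<cdot> g) \<cdot> f = h \<cdot> (g \<cdot> f)"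

definition is_iso :: "('o, 'a, 'm) cat_scheme \<Rightarrow> 'a \<Rightarrow> bool" where
  "is_iso C f \<longleftrightarrow> f \<in> Arr C \<and>
     (\<exists>g \<in> hom C (tgt C f) (src C f).
        g \<cdot>\<^bsub>C\<^esub> f = ident C (src C f) \<and> f \<cdot>\<^bsub>C\<^esub> g = ident C (tgt C f))"

definition is_mono :: "('o, 'a, 'm) cat_scheme \<Rightarrow> 'a \<Rightarrow> bool" where
  "is_mono C f \<longleftrightarrow> f \<in> Arr C \<and>
     (\<forall>Z \<in> Ob C. \<forall>u \<in> hom C Z (src C f). \<forall>v \<in> hom C Z (src C f).
        f \<cdot>\<^bsub>C\<^esub> u = f \<cdot>\<^bsub>C\<^esub> v \<longrightarrow> u = v)"

record ('o, 'a, 'p, 'b) func =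
  Fo :: "'o \<Rightarrow> 'p"
  Fa :: "'a \<Rightarrow> 'b"

definition is_functor ::
  "('o, 'a, 'm) cat_scheme \<Rightarrow> ('p, 'b, 'n) cat_scheme \<Rightarrow> ('o, 'a, 'p, 'b) func \<Rightarrow> bool" where
  "is_functor C D F \<longleftrightarrow> category C \<and> category D \<and>
     (\<forall>X \<in> Ob C. Fo F X \<in> Ob D) \<and>
     (\<forall>X \<in> Ob C. \<forall>Y \<in> Ob C. \<forall>f \<in> hom C X Y. Fa F f \<in> hom D (Fo F X) (Fo F Y)) \<and>
     (\<forall>X \<in> Ob C. Fa F (ident C X) = ident D (Fo F X)) \<and>
     (\<forall>X \<in> Ob C. \<forall>Y \<in> Ob C. \<forall>Z \<in> Ob C. \<forall>f \<in> hom C X Y. \<forall>g \<in> hom C Y Z.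
        Fa F (g \<cdot>\<^bsub>C\<^esub> f) = Fa F g \<cdot>\<^bsub>D\<^esub> Fa F f)"

definition prod_cat ::
  "('o, 'a, 'm) cat_scheme \<Rightarrow> ('p, 'b, 'n) cat_scheme \<Rightarrow> ('o \<times> 'p, 'a \<times> 'b) cat" where
  "prod_cat C D =
     \<lparr> Ob = Ob C \<times> Ob D,
       Arr = Arr C \<times> Arr D,
       src = map_prod (src C) (src D),
       tgt = map_prod (tgt C) (tgt D),
       ident = map_prod (ident C) (ident D),
       cmp = (\<lambda>(g, g') (f, f'). (g \<cdot>\<^bsub>C\<^esub> f, g' \<cdot>\<^bsub>D\<^esub> f')) \<rparr>"

text \<open>\<open>F\<close> is left adjoint to \<open>G\<close> via the natural bijections \<open>\<phi> X Z : D(F X, Z) \<rightarrow> C(X, G Z)\<close>.\<close>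

definition is_adjunction ::
  "('o, 'a, 'm) cat_scheme \<Rightarrow> ('p, 'b, 'n) cat_scheme \<Rightarrow> ('o, 'a, 'p, 'b) func \<Rightarrow>
   ('p, 'b, 'o, 'a) func \<Rightarrow> ('o \<Rightarrow> 'p \<Rightarrow> 'b \<Rightarrow> 'a) \<Rightarrow> bool" where
  "is_adjunction C D F G \<phi> \<longleftrightarrow> is_functor C D F \<and> is_functor D C G \<and>
     (\<forall>X \<in> Ob C. \<forall>Z \<in> Ob D. bij_betw (\<phi> X Z) (hom D (Fo F X) Z) (hom C X (Fo G Z))) \<and>
     (\<forall>X \<in> Ob C. \<forall>X' \<in> Ob C. \<forall>Z \<in> Ob D. \<forall>Z' \<in> Ob D.
        \<forall>f \<in> hom C X' X. \<forall>h \<in> hom D (Fo F X) Z. \<forall>k \<in> hom D Z Z'.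
          \<phi> X' Z' (k \<cdot>\<^bsub>D\<^esub> h \<cdot>\<^bsub>D\<^esub> Fa F f) = Fa G k \<cdot>\<^bsub>C\<^esub> \<phi> X Z h \<cdot>\<^bsub>C\<^esub> f)"

definition has_right_adjoint ::
  "('o, 'a, 'm) cat_scheme \<Rightarrow> ('p, 'b, 'n) cat_scheme \<Rightarrow> ('o, 'a, 'p, 'b) func \<Rightarrow> bool" where
  "has_right_adjoint C D F \<longleftrightarrow> (\<exists>G \<phi>. is_adjunction C D F G \<phi>)"

record ('o, 'a) smc = "('o, 'a) cat" +
  tensor :: "('o \<times> 'o, 'a \<times> 'a, 'o, 'a) func"
  unit :: 'o
  assoc :: "'o \<Rightarrow> 'o \<Rightarrow> 'o \<Rightarrow> 'a"
  lunit :: "'o \<Rightarrow> 'a"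
  runit :: "'o \<Rightarrow> 'a"
  braid :: "'o \<Rightarrow> 'o \<Rightarrow> 'a"

definition tens_ob :: "('o, 'a, 'm) smc_scheme \<Rightarrow> 'o \<Rightarrow> 'o \<Rightarrow> 'o"  (infixr "\<otimes>\<index>" 70) where
  "X \<otimes>\<^bsub>C\<^esub> Y = Fo (tensor C) (X, Y)"

definition tens_arr :: "('o, 'a, 'm) smc_scheme \<Rightarrow> 'a \<Rightarrow> 'a \<Rightarrow> 'a"  (infixr "\<boxtimes>\<index>" 70) where
  "f \<boxtimes>\<^bsub>C\<^esub> g = Fa (tensor C) (f, g)"

locale monoidal_category = category C
  for C :: "('o, 'a, 'm) smc_scheme" (structure) +
  assumes tensor_functor: "is_functor (prod_cat C C) C (tensor C)"
    and unit_in_Ob: "unit C \<in> Ob C"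
    and assoc_in_hom: "\<lbrakk>X \<in> Ob C; Y \<in> Ob C; Z \<in> Ob C\<rbrakk>
          \<Longrightarrow> assoc C X Y Z \<in> hom C ((X \<otimes> Y) \<otimes> Z) (X \<otimes> (Y \<otimes> Z))"
    and assoc_iso: "\<lbrakk>X \<in> Ob C; Y \<in> Ob C; Z \<in> Ob C\<rbrakk> \<Longrightarrow> is_iso C (assoc C X Y Z)"
    and assoc_natural: "\<lbrakk>f \<in> hom C X X'; g \<in> hom C Y Y'; h \<in> hom C Z Z'\<rbrakk>
          \<Longrightarrow> assoc C X' Y' Z' \<cdot> ((f \<boxtimes> g) \<boxtimes> h) = (f \<boxtimes> (g \<boxtimes> h)) \<cdot> assoc C X Y Z"
    and lunit_in_hom: "X \<in> Ob C \<Longrightarrow> lunit C X \<in> hom C (unit C \<otimes> X) X"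
    and lunit_iso: "X \<in> Ob C \<Longrightarrow> is_iso C (lunit C X)"
    and lunit_natural: "f \<in> hom C X X'
          \<Longrightarrow> lunit C X' \<cdot> (ident C (unit C) \<boxtimes> f) = f \<cdot> lunit C X"
    and runit_in_hom: "X \<in> Ob C \<Longrightarrow> runit C X \<in> hom C (X \<otimes> unit C) X"
    and runit_iso: "X \<in> Ob C \<Longrightarrow> is_iso C (runit C X)"
    and runit_natural: "f \<in> hom C X X'
          \<Longrightarrow> runit C X' \<cdot> (f \<boxtimes> ident C (unit C)) = f \<cdot> runit C X"
    and pentagon: "\<lbrakk>W \<in> Ob C; X \<in> Ob C; Y \<in> Ob C; Z \<in> Ob C\<rbrakk>
          \<Longrightarrow> assoc C W X (Y \<otimes> Z) \<cdot> assoc C (W \<otimes> X) Y Z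
              = (ident C W \<boxtimes> assoc C X Y Z) \<cdot> assoc C W (X \<otimes> Y) Z
                  \<cdot> (assoc C W X Y \<boxtimes> ident C Z)"
    and triangle: "\<lbrakk>X \<in> Ob C; Y \<in> Ob C\<rbrakk>
          \<Longrightarrow> (ident C X \<boxtimes> lunit C Y) \<cdot> assoc C X (unit C) Y = runit C X \<boxtimes> ident C Y"

locale symmetric_monoidal_category = monoidal_category C
  for C :: "('o, 'a, 'm) smc_scheme" (structure) +
  assumes braid_in_hom: "\<lbrakk>X \<in> Ob C; Y \<in> Ob C\<rbrakk> \<Longrightarrow> braid C X Y \<in> hom C (X \<otimes> Y) (Y \<otimes> X)"
    and braid_natural: "\<lbrakk>f \<in> hom C X X'; g \<in> hom C Y Y'\<rbrakk>
          \<Longrightarrow> braid C X' Y' \<cdot> (f \<boxtimes> g) = (g \<boxtimes> f) \<cdot> braid C X Y"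
    and braid_symmetric: "\<lbrakk>X \<in> Ob C; Y \<in> Ob C\<rbrakk>
          \<Longrightarrow> braid C Y X \<cdot> braid C X Y = ident C (X \<otimes> Y)"
    and hexagon: "\<lbrakk>X \<in> Ob C; Y \<in> Ob C; Z \<in> Ob C\<rbrakk>
          \<Longrightarrow> assoc C Y Z X \<cdot> braid C X (Y \<otimes> Z) \<cdot> assoc C X Y Z
              = (ident C Y \<boxtimes> braid C X Z) \<cdot> assoc C Y X Z \<cdot> (braid C X Y \<boxtimes> ident C Z)"

definition tensor_right :: "('o, 'a, 'm) smc_scheme \<Rightarrow> 'o \<Rightarrow> ('o, 'a, 'o, 'a) func" where
  "tensor_right C Y = \<lparr> Fo = (\<lambda>X. X \<otimes>\<^bsub>C\<^esub> Y), Fa = (\<lambda>f. f \<boxtimes>\<^bsub>C\<^esub> ident C Y) \<rparr>"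

locale symmetric_monoidal_closed_category = symmetric_monoidal_category C
  for C :: "('o, 'a, 'm) smc_scheme" (structure) +
  assumes closed: "Y \<in> Ob C \<Longrightarrow> has_right_adjoint C C (tensor_right C Y)"

definition is_cone ::
  "('i, 'j, 'l) cat_scheme \<Rightarrow> ('o, 'a, 'm) cat_scheme \<Rightarrow> ('i, 'j, 'o, 'a) func \<Rightarrow>
   'o \<Rightarrow> ('i \<Rightarrow> 'a) \<Rightarrow> bool" where
  "is_cone J C d X p \<longleftrightarrow> X \<in> Ob C \<and>
     (\<forall>i \<in> Ob J. p i \<in> hom C X (Fo d i)) \<and>
     (\<forall>i \<in> Ob J. \<forall>j \<in> Ob J. \<forall>e \<in> hom J i j. Fa d e \<cdot>\<^bsub>C\<^esub> p i = p j)"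

definition is_limit ::
  "('i, 'j, 'l) cat_scheme \<Rightarrow> ('o, 'a, 'm) cat_scheme \<Rightarrow> ('i, 'j, 'o, 'a) func \<Rightarrow>
   'o \<Rightarrow> ('i \<Rightarrow> 'a) \<Rightarrow> bool" where
  "is_limit J C d X p \<longleftrightarrow> is_cone J C d X p \<and>
     (\<forall>Y q. is_cone J C d Y q \<longrightarrow> (\<exists>!u. u \<in> hom C Y X \<and> (\<forall>i \<in> Ob J. p i \<cdot>\<^bsub>C\<^esub> u = q i)))"

definition is_cocone ::
  "('i, 'j, 'l) cat_scheme \<Rightarrow> ('o, 'a, 'm) cat_scheme \<Rightarrow> ('i, 'j, 'o, 'a) func \<Rightarrow>
   'o \<Rightarrow> ('i \<Rightarrow> 'a) \<Rightarrow> bool" where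
  "is_cocone J C d X p \<longleftrightarrow> X \<in> Ob C \<and>
     (\<forall>i \<in> Ob J. p i \<in> hom C (Fo d i) X) \<and>
     (\<forall>i \<in> Ob J. \<forall>j \<in> Ob J. \<forall>e \<in> hom J i j. p j \<cdot>\<^bsub>C\<^esub> Fa d e = p i)"

definition is_colimit ::
  "('i, 'j, 'l) cat_scheme \<Rightarrow> ('o, 'a, 'm) cat_scheme \<Rightarrow> ('i, 'j, 'o, 'a) func \<Rightarrow>
   'o \<Rightarrow> ('i \<Rightarrow> 'a) \<Rightarrow> bool" where
  "is_colimit J C d X p \<longleftrightarrow> is_cocone J C d X p \<and>
     (\<forall>Y q. is_cocone J C d Y q \<longrightarrow> (\<exists>!u. u \<in> hom C X Y \<and> (\<forall>i \<in> Ob J. u \<cdot>\<^bsub>C\<^esub> p i = q i)))"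

text \<open>
  Small index sets and small index categories are taken with elements in the type \<open>'k\<close>
  carrying \<open>\<kappa>\<close>. This is no restriction up to isomorphism: every set with fewer than \<open>\<kappa>\<close>
  elements injects into \<open>'k\<close>.
\<close>

definition small_category :: "'k rel \<Rightarrow> ('i, 'j, 'm) cat_scheme \<Rightarrow> bool" where
  "small_category \<kappa> J \<longleftrightarrow> category J \<and> small \<kappa> (Ob J) \<and> small \<kappa> (Arr J)"

definition small_complete :: "'k rel \<Rightarrow> ('o, 'a, 'm) cat_scheme \<Rightarrow> bool" where
  "small_complete \<kappa> C \<longleftrightarrow>
     (\<forall>(J :: ('k, 'k) cat) d. small_category \<kappa> J \<and> is_functor J C d \<longrightarrow> (\<exists>X p. is_limit J C d X p))"

definition small_cocomplete :: "'k rel \<Rightarrow> ('o, 'a, 'm) cat_scheme \<Rightarrow> bool" where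
  "small_cocomplete \<kappa> C \<longleftrightarrow>
     (\<forall>(J :: ('k, 'k) cat) d. small_category \<kappa> J \<and> is_functor J C d \<longrightarrow> (\<exists>X p. is_colimit J C d X p))"

definition locally_small :: "'k rel \<Rightarrow> ('o, 'a, 'm) cat_scheme \<Rightarrow> bool" where
  "locally_small \<kappa> C \<longleftrightarrow> (\<forall>X \<in> Ob C. \<forall>Y \<in> Ob C. small \<kappa> (hom C X Y))"

definition monos_into :: "('o, 'a, 'm) cat_scheme \<Rightarrow> 'o \<Rightarrow> 'a set" where
  "monos_into C X = {m. is_mono C m \<and> tgt C m = X}"

definition subobject_iso :: "('o, 'a, 'm) cat_scheme \<Rightarrow> 'o \<Rightarrow> 'a rel" where
  "subobject_iso C X = {(m, n). m \<in> monos_into C X \<and> n \<in> monos_into C X \<and>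
     (\<exists>i \<in> hom C (src C m) (src C n). is_iso C i \<and> n \<cdot>\<^bsub>C\<^esub> i = m)}"

definition well_powered :: "'k rel \<Rightarrow> ('o, 'a, 'm) cat_scheme \<Rightarrow> bool" where
  "well_powered \<kappa> C \<longleftrightarrow> (\<forall>X \<in> Ob C. small \<kappa> (monos_into C X // subobject_iso C X))"

definition cogenerating_family :: "('o, 'a, 'm) cat_scheme \<Rightarrow> 's set \<Rightarrow> ('s \<Rightarrow> 'o) \<Rightarrow> bool" where
  "cogenerating_family C S G \<longleftrightarrow> (\<forall>s \<in> S. G s \<in> Ob C) \<and>
     (\<forall>X \<in> Ob C. \<forall>Z \<in> Ob C. \<forall>u \<in> hom C Z X. \<forall>v \<in> hom C Z X.
        (\<forall>s \<in> S. \<forall>h \<in> hom C X (G s). h \<cdot>\<^bsub>C\<^esub> u = h \<cdot>\<^bsub>C\<^esub> v) \<longrightarrow> u = v)"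

definition has_small_cogenerating_family :: "'k rel \<Rightarrow> ('o, 'a, 'm) cat_scheme \<Rightarrow> bool" where
  "has_small_cogenerating_family \<kappa> C \<longleftrightarrow>
     (\<exists>(S :: 'k set) G. small \<kappa> S \<and> cogenerating_family C S G)"

end

theory Submission
  imports Defs "HOL-Library.FuncSet"
begin

text \<open>
  The theorem is an instance of the special adjoint functor theorem, applied to the diagonal
  functor. Given a small diagram \<open>d\<close>, let \<open>P\<close>
  be the product of copies of the cogenerators \<open>G s\<close>, one for each cocone from \<open>d\<close> to some
  \<open>G s\<close>. These cocones form a cocone from \<open>d\<close> to \<open>P\<close>. Let \<open>M\<close> be the intersection of all
  subobjects of \<open>P\<close> to which this cocone lifts. Two arrows out of \<open>M\<close> that agree on the cocone
  are equal, since their equalizer is such a subobject. A cocone from \<open>d\<close> to \<open>Y\<close> factors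
  through \<open>M\<close>, since \<open>Y\<close> is a subobject of a product of cogenerators, and its pullback to \<open>P\<close>
  is such a subobject.
\<close>

subsection \<open>Small sets\<close>

lemma small_subset: "small \<kappa> B \<Longrightarrow> A \<subseteq> B \<Longrightarrow> small \<kappa> A"
  unfolding small_def by (meson card_of_mono1 ordLeq_ordLess_trans)

lemma small_image: "small \<kappa> A \<Longrightarrow> small \<kappa> (f ` A)"
  unfolding small_def by (meson card_of_image ordLeq_ordLess_trans)

lemma small_inj_on: "inj_on f A \<Longrightarrow> small \<kappa> (f ` A) \<Longrightarrow> small \<kappa> A"
  unfolding small_def by (meson card_of_ordLeq ordLeq_ordLess_trans subset_refl)

text \<open>A set of cardinality below \<kappa> is equinumerous with a subset of the field of
  \<kappa>. This lets small index sets of any type be copied into \<open>'k\<close>, the type over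
  which \<open>small_complete\<close> quantifies.\<close>

lemma small_imp_inj_on:
  assumes "small (\<kappa> :: 'k rel) A"
  obtains f :: "'x \<Rightarrow> 'k" where "inj_on f A"
proof -
  obtain B :: "'k set" where "|A| =o |B|"
    using assms internalize_card_of_ordLess[of A \<kappa>] unfolding small_def by blast
  then show thesis
    using that card_of_ordIso[of A B] by (auto simp: bij_betw_def)
qed

lemma small_finite:
  assumes "universe_cardinal \<kappa>" "finite A"
  shows "small \<kappa> A"
proof -
  have "|Field \<kappa>| =o \<kappa>" "infinite (Field \<kappa>)"
    using assms(1) card_of_Field_ordIso unfolding universe_cardinal_def cinfinite_def by auto
  then show ?thesis
    using finite_ordLess_infinite[of "|A|" "|Field \<kappa>|"] assms(2) unfolding small_def
    by (metis Field_card_of card_of_Well_order ordLess_ordIso_trans)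
qed

lemma small_Plus:
  assumes "universe_cardinal \<kappa>" "small \<kappa> A" "small \<kappa> B"
  shows "small \<kappa> (A <+> B)"
  using assms card_of_Plus_ordLess_infinite_Field[of \<kappa> A B]
  unfolding universe_cardinal_def cinfinite_def small_def by simp

lemma small_Un:
  assumes "universe_cardinal \<kappa>" "small \<kappa> A" "small \<kappa> B"
  shows "small \<kappa> (A \<union> B)"
  using assms card_of_Un_ordLess_infinite_Field[of \<kappa> A B]
  unfolding universe_cardinal_def cinfinite_def small_def by simp

text \<open>Regularity of \<kappa> enters here: an infinite regular cardinal is stable, i.e. closed
  under dependent sums of small families of small sets.\<close>

lemma small_Sigma:
  assumes "universe_cardinal \<kappa>" "small \<kappa> A" "\<And>a. a \<in> A \<Longrightarrow> small \<kappa> (F a)"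
  shows "small \<kappa> (Sigma A F)"
  using assms stable_elim[OF regularCard_stable, of \<kappa> A F]
  unfolding universe_cardinal_def cinfinite_def small_def by simp

text \<open>The strong limit condition speaks only of sets over \<open>'k\<close>, so
  \<open>A\<close> is first embedded there; taking direct images under the embedding is injective on
  \<open>Pow A\<close>.\<close>

lemma small_Pow:
  assumes "universe_cardinal (\<kappa> :: 'k rel)" "small \<kappa> A"
  shows "small \<kappa> (Pow A)"
proof -
  obtain f :: "_ \<Rightarrow> 'k" where f: "inj_on f A"
    using small_imp_inj_on[OF assms(2)] .
  have "small \<kappa> (Pow (f ` A))"
    using assms(1) small_image[OF assms(2), of f] unfolding universe_cardinal_def small_def by blast
  then have "small \<kappa> ((`) f ` Pow A)"
    by (rule small_subset) auto
  then show ?thesis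
    by (rule small_inj_on[OF inj_on_image_Pow[OF f]])
qed

text \<open>An extensional function is determined by its graph over \<open>A\<close>, which is a
  subset of \<open>Sigma A F\<close>; so \<open>PiE A F\<close> embeds into a small power
  set.\<close>

lemma small_PiE:
  assumes "universe_cardinal \<kappa>" "small \<kappa> A" "\<And>a. a \<in> A \<Longrightarrow> small \<kappa> (F a)"
  shows "small \<kappa> (PiE A F)"
proof (rule small_inj_on)
  let ?graph = "\<lambda>f. {(a, f a) | a. a \<in> A}"
  show "inj_on ?graph (PiE A F)"
  proof (rule inj_onI)
    fix f g
    assume f: "f \<in> PiE A F" and g: "g \<in> PiE A F" and eq: "?graph f = ?graph g"
    have "f a = g a" if "a \<in> A" for a
    proof -
      have "(a, f a) \<in> ?graph g"
        using that eq by blast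
      then show ?thesis by blast
    qed
    then show "f = g"
      using PiE_ext[OF f g] by blast
  qed
  show "small \<kappa> (?graph ` PiE A F)"
    by (rule small_subset[OF small_Pow[OF assms(1) small_Sigma[OF assms]]]) auto
qed


subsection \<open>Categories, monomorphisms and subobjects\<close>

context category
begin

lemma hom_Ob:
  assumes "f \<in> hom C X Y"
  shows "X \<in> Ob C" "Y \<in> Ob C"
  using assms src_in_Ob tgt_in_Ob unfolding hom_def by auto

lemma mono_cancel:
  assumes "is_mono C m" "m \<in> hom C M P" "u \<in> hom C Z M" "v \<in> hom C Z M" "m \<cdot> u = m \<cdot> v"
  shows "u = v"
  using assms hom_Ob(1)[OF assms(3)] unfolding is_mono_def hom_def by auto

lemma is_monoI:
  assumes "m \<in> hom C M P"
    and "\<And>Z u v. u \<in> hom C Z M \<Longrightarrow> v \<in> hom C Z M \<Longrightarrow> m \<cdot> u = m \<cdot> v \<Longrightarrow> u = v"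
  shows "is_mono C m"
  using assms unfolding is_mono_def hom_def by auto

lemma subobject_iso_refl:
  assumes "is_mono C n" "n \<in> hom C N P"
  shows "(n, n) \<in> subobject_iso C P"
proof -
  have N: "N \<in> Ob C" and id: "ident C N \<in> hom C N N"
    using hom_Ob(1)[OF assms(2)] ident_in_hom by auto
  then have "is_iso C (ident C N)"
    using cmp_ident_left[OF id] unfolding is_iso_def by (auto simp: hom_def)
  then show ?thesis
    using assms id cmp_ident_right[OF assms(2)]
    unfolding subobject_iso_def monos_into_def by (auto simp: hom_def)
qed

text \<open>The factor is the inverse of the isomorphism that identifies \<open>n\<close> with
  \<open>m\<close>. It serves to pass from a chosen representative of a subobject to another member
  of the class.\<close>

lemma subobject_iso_factor:
  assumes "(n, m) \<in> subobject_iso C P" "n \<in> hom C N P"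
  obtains g where "g \<in> hom C (src C m) N" "n \<cdot> g = m"
proof -
  obtain i where i: "i \<in> hom C N (src C m)" "is_iso C i" "m \<cdot> i = n"
    and m: "m \<in> hom C (src C m) P"
    using assms unfolding subobject_iso_def monos_into_def is_mono_def hom_def by auto
  then obtain g where g: "g \<in> hom C (src C m) N" "i \<cdot> g = ident C (src C m)"
    unfolding is_iso_def hom_def by auto
  have "n \<cdot> g = m"
    using cmp_assoc[OF g(1) i(1) m] g(2) i(3) cmp_ident_right[OF m] by simp
  then show thesis
    using that g(1) by blast
qed

end


subsection \<open>Limits of small diagrams indexed by arbitrary types\<close>

locale small_complete_category = category C
  for C :: "('o, 'a, 'm) cat_scheme" (structure) +
  fixes \<kappa> :: "'k rel"
  assumes universe: "universe_cardinal \<kappa>"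
    and complete: "small_complete \<kappa> C"
begin

text \<open>\<open>small_complete\<close> provides limits only for index categories whose objects
  and arrows lie in \<open>'k\<close>. A small \<open>J\<close> over other types is replaced by an
  isomorphic copy \<open>K\<close> over \<open>'k\<close>, and the limit is carried back.\<close>

lemma small_limit:
  fixes J :: "('i, 'j, 'n) cat_scheme"
  assumes J: "small_category \<kappa> J" and d: "is_functor J C d"
  obtains X p where "is_limit J C d X p"
proof -
  interpret J: category J
    using J unfolding small_category_def by simp
  obtain a :: "'i \<Rightarrow> 'k" where a: "inj_on a (Ob J)"
    using J small_imp_inj_on unfolding small_category_def by blast
  obtain b :: "'j \<Rightarrow> 'k" where b: "inj_on b (Arr J)"
    using J small_imp_inj_on unfolding small_category_def by blast
  define a' where "a' = inv_into (Ob J) a"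
  define b' where "b' = inv_into (Arr J) b"
  have a' [simp]: "a' (a i) = i" if "i \<in> Ob J" for i
    using a that unfolding a'_def by simp
  have b' [simp]: "b' (b e) = e" if "e \<in> Arr J" for e
    using b that unfolding b'_def by simp
  \<comment> \<open>\<open>K\<close> is \<open>J\<close> with objects renamed by \<open>a\<close>
    and arrows by \<open>b\<close>: each operation decodes with \<open>a'\<close> and
    \<open>b'\<close>, works in \<open>J\<close>, and encodes the result.\<close>
  define K :: "('k, 'k) cat" where "K = \<lparr> Ob = a ` Ob J, Arr = b ` Arr J,
    src = (\<lambda>e. a (src J (b' e))), tgt = (\<lambda>e. a (tgt J (b' e))),
    ident = (\<lambda>i. b (ident J (a' i))), cmp = (\<lambda>g f. b (b' g \<cdot>\<^bsub>J\<^esub> b' f)) \<rparr>"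
  have Ob_K: "Ob K = a ` Ob J" and ident_K: "ident K i = b (ident J (a' i))"
    and cmp_K: "g \<cdot>\<^bsub>K\<^esub> f = b (b' g \<cdot>\<^bsub>J\<^esub> b' f)" for i g f
    unfolding K_def by auto
  have hom_K: "hom K (a i) (a j) = b ` hom J i j" if "i \<in> Ob J" "j \<in> Ob J" for i j
    using that inj_onD[OF a] J.src_in_Ob J.tgt_in_Ob
    unfolding hom_def K_def by (auto simp: image_iff)
  have hom_K_E: "\<exists>i j e. i \<in> Ob J \<and> j \<in> Ob J \<and> e \<in> hom J i j \<and> x = a i \<and> y = a j \<and> f = b e"
    if "f \<in> hom K x y" for x y f
    using that J.src_in_Ob J.tgt_in_Ob unfolding hom_def K_def by (auto, blast)
  have hom_Arr: "e \<in> hom J i j \<Longrightarrow> e \<in> Arr J" for e i j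
    unfolding hom_def by simp
  have K: "category K"
  proof
    show "src K f \<in> Ob K" "tgt K f \<in> Ob K" if "f \<in> Arr K" for f
      using that J.src_in_Ob J.tgt_in_Ob unfolding K_def by auto
    show "ident K x \<in> hom K x x" if "x \<in> Ob K" for x
      using that J.ident_in_hom by (auto simp: Ob_K ident_K hom_K)
    show "g \<cdot>\<^bsub>K\<^esub> f \<in> hom K x z" if f: "f \<in> hom K x y" and g: "g \<in> hom K y z" for f g x y z
    proof -
      obtain i j e where e: "i \<in> Ob J" "j \<in> Ob J" "e \<in> hom J i j" "x = a i" "y = a j" "f = b e"
        using hom_K_E[OF f] by blast
      obtain j' k e' where e': "j' \<in> Ob J" "k \<in> Ob J" "e' \<in> hom J j' k" "y = a j'" "z = a k" "g = b e'"
        using hom_K_E[OF g] by blast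
      have "j' = j"
        using e e' inj_onD[OF a] by blast
      then show ?thesis
        using e e' J.cmp_in_hom[of e i j e' k] by (simp add: cmp_K hom_K hom_Arr)
    qed
    show "f \<cdot>\<^bsub>K\<^esub> ident K x = f" "ident K y \<cdot>\<^bsub>K\<^esub> f = f" if "f \<in> hom K x y" for f x y
      using hom_K_E[OF that] hom_Arr[OF J.ident_in_hom] J.cmp_ident_right J.cmp_ident_left
      by (force simp: ident_K cmp_K hom_Arr)+
    show "(h \<cdot>\<^bsub>K\<^esub> g) \<cdot>\<^bsub>K\<^esub> f = h \<cdot>\<^bsub>K\<^esub> (g \<cdot>\<^bsub>K\<^esub> f)"
      if f: "f \<in> hom K w x" and g: "g \<in> hom K x y" and h: "h \<in> hom K y z" for f g h w x y z
    proof -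
      obtain i j e where e: "i \<in> Ob J" "j \<in> Ob J" "e \<in> hom J i j" "w = a i" "x = a j" "f = b e"
        using hom_K_E[OF f] by blast
      obtain j' k e' where e': "j' \<in> Ob J" "k \<in> Ob J" "e' \<in> hom J j' k" "x = a j'" "y = a k" "g = b e'"
        using hom_K_E[OF g] by blast
      obtain k' l e'' where e'': "k' \<in> Ob J" "l \<in> Ob J" "e'' \<in> hom J k' l" "y = a k'" "z = a l" "h = b e''"
        using hom_K_E[OF h] by blast
      have [simp]: "j' = j" "k' = k"
        using e e' e'' inj_onD[OF a] by blast+
      show ?thesis
        using e e' e'' J.cmp_in_hom[of e i j e' k] J.cmp_in_hom[of e' j k e'' l]
          J.cmp_assoc[of e i j e' k e'' l] by (simp add: cmp_K hom_Arr)
    qed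
  qed
  have small_K: "small_category \<kappa> K"
    using J K unfolding small_category_def K_def by (simp add: small_image)
  define d' :: "('k, 'k, 'o, 'a) func" where "d' = \<lparr> Fo = Fo d \<circ> a', Fa = Fa d \<circ> b' \<rparr>"
  have Fo_d': "Fo d' (a i) = Fo d i" if "i \<in> Ob J" for i
    using that unfolding d'_def by simp
  have Fa_d': "Fa d' (b e) = Fa d e" if "e \<in> hom J i j" for e i j
    using that hom_Arr unfolding d'_def by simp
  have "is_functor K C d'"
    using d K J.ident_in_hom J.cmp_in_hom unfolding is_functor_def
    by (auto simp: Ob_K hom_K Fo_d' Fa_d' Fa_d'[OF J.ident_in_hom] Fa_d'[OF J.cmp_in_hom]
        ident_K cmp_K hom_Arr)
  then obtain X p where Xp: "is_limit K C d' X p"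
    using complete small_K unfolding small_complete_def by blast
  \<comment> \<open>Relabelling the legs matches the cones over the two diagrams, so the universal
    property transfers from \<open>K\<close> to \<open>J\<close>.\<close>
  have cone: "is_cone K C d' Y q \<longleftrightarrow> is_cone J C d Y (q \<circ> a)" for Y q
    unfolding is_cone_def by (auto simp: Ob_K hom_K Fo_d' Fa_d')
  have "is_limit J C d X (p \<circ> a)"
    unfolding is_limit_def
  proof (intro conjI allI impI)
    show "is_cone J C d X (p \<circ> a)"
      using Xp cone unfolding is_limit_def by blast
    fix Y q
    assume q: "is_cone J C d Y q"
    then have "is_cone K C d' Y (q \<circ> a')"
      unfolding cone by (simp add: is_cone_def)
    then have "\<exists>!u. u \<in> hom C Y X \<and> (\<forall>i \<in> Ob K. p i \<cdot> u = (q \<circ> a') i)"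
      using Xp unfolding is_limit_def by blast
    then show "\<exists>!u. u \<in> hom C Y X \<and> (\<forall>i \<in> Ob J. (p \<circ> a) i \<cdot> u = q i)"
      by (simp add: Ob_K)
  qed
  then show thesis
    using that by blast
qed

text \<open>
  The diagrams needed below are bipartite graphs, which are categories once identities are added
  because no two of their edges compose.
\<close>

lemma bipartite_limit:
  fixes V :: "'v set" and E :: "'e set"
  assumes V: "small \<kappa> V" and E: "small \<kappa> E"
    and A: "\<And>v. v \<in> V \<Longrightarrow> A v \<in> Ob C"
    and ends: "\<And>e. e \<in> E \<Longrightarrow> s e \<in> V \<and> t e \<in> V"
    and bipartite: "\<And>e e'. e \<in> E \<Longrightarrow> e' \<in> E \<Longrightarrow> s e \<noteq> t e'"
    and f: "\<And>e. e \<in> E \<Longrightarrow> f e \<in> hom C (A (s e)) (A (t e))"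
  obtains X p where "X \<in> Ob C" "\<And>v. v \<in> V \<Longrightarrow> p v \<in> hom C X (A v)"
    and "\<And>e. e \<in> E \<Longrightarrow> f e \<cdot> p (s e) = p (t e)"
    and "\<And>Y q. Y \<in> Ob C \<Longrightarrow> (\<And>v. v \<in> V \<Longrightarrow> q v \<in> hom C Y (A v)) \<Longrightarrow>
           (\<And>e. e \<in> E \<Longrightarrow> f e \<cdot> q (s e) = q (t e)) \<Longrightarrow> \<exists>u \<in> hom C Y X. \<forall>v \<in> V. p v \<cdot> u = q v"
    and "\<And>Y u w. u \<in> hom C Y X \<Longrightarrow> w \<in> hom C Y X \<Longrightarrow> (\<And>v. v \<in> V \<Longrightarrow> p v \<cdot> u = p v \<cdot> w) \<Longrightarrow> u = w"
proof -
  \<comment> \<open>\<open>Inl v\<close> is the identity of \<open>v\<close>, and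
    \<open>Inr e\<close> is an edge. In a composable pair at least one arrow is an identity; the
    case distinction on the first arrow returns the other one.\<close>
  define J :: "('v, 'v + 'e) cat" where "J = \<lparr> Ob = V, Arr = V <+> E, src = case_sum id s,
    tgt = case_sum id t, ident = Inl, cmp = (\<lambda>g f. case f of Inl _ \<Rightarrow> g | Inr _ \<Rightarrow> f) \<rparr>"
  define d :: "('v, 'v + 'e, 'o, 'a) func" where
    "d = \<lparr> Fo = A, Fa = case_sum (ident C \<circ> A) f \<rparr>"
  have hom_J: "hom J x y = Inl ` {v. v \<in> V \<and> v = x \<and> v = y} \<union> Inr ` {e \<in> E. s e = x \<and> t e = y}" for x y
    unfolding hom_def J_def by auto
  have J_sel [simp]: "Ob J = V" "ident J = Inl" "g \<cdot>\<^bsub>J\<^esub> Inl v = g" "g \<cdot>\<^bsub>J\<^esub> Inr e = Inr e"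
    "Fo d = A" "Fa d (Inl v) = ident C (A v)" "Fa d (Inr e) = f e" for g v e
    unfolding J_def d_def by auto
  have J: "category J"
  proof
    show "src J e \<in> Ob J" "tgt J e \<in> Ob J" if "e \<in> Arr J" for e
      using that ends unfolding J_def by auto
  qed (auto simp: hom_J bipartite)
  have small_J: "small_category \<kappa> J"
    using J V small_Plus[OF universe V E] unfolding small_category_def J_def by simp
  have d: "is_functor J C d"
    using category_axioms J A f ident_in_hom bipartite cmp_ident_left[OF f] cmp_ident_right[OF f]
      cmp_ident_left[OF ident_in_hom[OF A]]
    unfolding is_functor_def by (auto simp: hom_J)
  obtain X p where Xp: "is_limit J C d X p"
    using small_limit[OF small_J d] .
  \<comment> \<open>Identities impose no condition on a cone, so only the equations for the edges
    remain.\<close>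
  have cone: "is_cone J C d Y q \<longleftrightarrow> Y \<in> Ob C \<and> (\<forall>v \<in> V. q v \<in> hom C Y (A v)) \<and>
      (\<forall>e \<in> E. f e \<cdot> q (s e) = q (t e))" for Y q
  proof -
    have "(\<forall>i \<in> V. \<forall>j \<in> V. \<forall>e \<in> hom J i j. Fa d e \<cdot> q i = q j) \<longleftrightarrow> (\<forall>e \<in> E. f e \<cdot> q (s e) = q (t e))"
      if "\<forall>v \<in> V. q v \<in> hom C Y (A v)"
      unfolding hom_J using ends cmp_ident_left that by (fastforce simp: ball_Un)
    then show ?thesis
      unfolding is_cone_def J_sel by blast
  qed
  show thesis
  proof (rule that)
    have p: "is_cone J C d X p"
      using Xp unfolding is_limit_def by blast
    then show "X \<in> Ob C" "\<And>v. v \<in> V \<Longrightarrow> p v \<in> hom C X (A v)"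
      "\<And>e. e \<in> E \<Longrightarrow> f e \<cdot> p (s e) = p (t e)"
      unfolding cone by blast+
    show "\<exists>u \<in> hom C Y X. \<forall>v \<in> V. p v \<cdot> u = q v"
      if "Y \<in> Ob C" "\<And>v. v \<in> V \<Longrightarrow> q v \<in> hom C Y (A v)"
        "\<And>e. e \<in> E \<Longrightarrow> f e \<cdot> q (s e) = q (t e)" for Y q
    proof -
      have "is_cone J C d Y q"
        unfolding cone using that by blast
      then have "\<exists>!u. u \<in> hom C Y X \<and> (\<forall>i \<in> Ob J. p i \<cdot> u = q i)"
        using Xp unfolding is_limit_def by blast
      then show ?thesis
        unfolding J_sel(1) by blast
    qed
    show "u = w" if u: "u \<in> hom C Y X" and w: "w \<in> hom C Y X"
      and eq: "\<And>v. v \<in> V \<Longrightarrow> p v \<cdot> u = p v \<cdot> w" for Y u w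
    proof -
      \<comment> \<open>Both \<open>u\<close> and \<open>w\<close> mediate the cone with legs
        \<open>p v \<cdot> u\<close>, so uniqueness of the mediating arrow identifies them.\<close>
      have "is_cone J C d Y (\<lambda>v. p v \<cdot> u)"
        using p hom_Ob(1)[OF u] cmp_in_hom[OF u] cmp_assoc[OF u] f ends unfolding cone by metis
      then have "\<exists>!k. k \<in> hom C Y X \<and> (\<forall>i \<in> Ob J. p i \<cdot> k = p i \<cdot> u)"
        using Xp unfolding is_limit_def by blast
      then show ?thesis
        unfolding J_sel(1) using u w eq by metis
    qed
  qed
qed

section \<open>Products, equalizers, wide pullbacks and intersections of subobjects\<close>

lemma product:
  assumes "small \<kappa> I" "\<And>i. i \<in> I \<Longrightarrow> A i \<in> Ob C"
  obtains P p where "P \<in> Ob C" "\<And>i. i \<in> I \<Longrightarrow> p i \<in> hom C P (A i)"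
    and "\<And>Y q. Y \<in> Ob C \<Longrightarrow> (\<And>i. i \<in> I \<Longrightarrow> q i \<in> hom C Y (A i)) \<Longrightarrow>
           \<exists>u \<in> hom C Y P. \<forall>i \<in> I. p i \<cdot> u = q i"
    and "\<And>Y u w. u \<in> hom C Y P \<Longrightarrow> w \<in> hom C Y P \<Longrightarrow> (\<And>i. i \<in> I \<Longrightarrow> p i \<cdot> u = p i \<cdot> w) \<Longrightarrow> u = w"
proof -
  \<comment> \<open>A product is the limit of a graph without edges. The type \<open>unit\<close>
    merely hosts the empty edge set, and the edge data are \<open>undefined\<close> because no edge
    ever consults them.\<close>
  obtain P p where P: "P \<in> Ob C" "\<And>i. i \<in> I \<Longrightarrow> p i \<in> hom C P (A i)"
    and ex: "\<And>Y q. Y \<in> Ob C \<Longrightarrow> (\<And>i. i \<in> I \<Longrightarrow> q i \<in> hom C Y (A i)) \<Longrightarrow>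
           (\<And>e::unit. e \<in> {} \<Longrightarrow> undefined \<cdot> q undefined = q undefined) \<Longrightarrow>
           \<exists>u \<in> hom C Y P. \<forall>i \<in> I. p i \<cdot> u = q i"
    and uniq: "\<And>Y u w. u \<in> hom C Y P \<Longrightarrow> w \<in> hom C Y P \<Longrightarrow>
           (\<And>i. i \<in> I \<Longrightarrow> p i \<cdot> u = p i \<cdot> w) \<Longrightarrow> u = w"
    using assms
    by (rule_tac V = I and E = "{} :: unit set" and A = A and f = "\<lambda>_. undefined"
        and s = "\<lambda>_. undefined" and t = "\<lambda>_. undefined" in bipartite_limit) (auto simp: small_finite[OF universe])
  show thesis
    by (rule that[OF P _ uniq]) (use ex in auto)
qed

text \<open>This is the limit of two parallel edges from the vertex \<open>True\<close> to the
  vertex \<open>False\<close>. The leg at \<open>False\<close> is \<open>u\<close> after the leg at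
  \<open>True\<close>, so the latter alone determines arrows into \<open>E\<close> and is
  monic.\<close>

lemma equalizer:
  assumes u: "u \<in> hom C X Y" and v: "v \<in> hom C X Y"
  obtains E e where "e \<in> hom C E X" "is_mono C e" "u \<cdot> e = v \<cdot> e"
    and "\<And>Z w. w \<in> hom C Z X \<Longrightarrow> u \<cdot> w = v \<cdot> w \<Longrightarrow> \<exists>k \<in> hom C Z E. e \<cdot> k = w"
proof -
  let ?A = "\<lambda>b. if b then X else Y"
  obtain E p where "E \<in> Ob C" and p: "\<And>b. b \<in> UNIV \<Longrightarrow> p b \<in> hom C E (?A b)"
    and eq: "\<And>b. b \<in> UNIV \<Longrightarrow> (if b then u else v) \<cdot> p True = p False"
    and ex: "\<And>Z q. Z \<in> Ob C \<Longrightarrow> (\<And>b. b \<in> UNIV \<Longrightarrow> q b \<in> hom C Z (?A b)) \<Longrightarrow>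
           (\<And>b. b \<in> UNIV \<Longrightarrow> (if b then u else v) \<cdot> q True = q False) \<Longrightarrow>
           \<exists>k \<in> hom C Z E. \<forall>b \<in> UNIV. p b \<cdot> k = q b"
    and uniq: "\<And>Z k l. k \<in> hom C Z E \<Longrightarrow> l \<in> hom C Z E \<Longrightarrow>
           (\<And>b. b \<in> UNIV \<Longrightarrow> p b \<cdot> k = p b \<cdot> l) \<Longrightarrow> k = l"
    using u v hom_Ob[OF u]
    by (rule_tac V = "UNIV :: bool set" and E = "UNIV :: bool set" and A = ?A
        and f = "\<lambda>b. if b then u else v" and s = "\<lambda>_. True" and t = "\<lambda>_. False"
        in bipartite_limit) (auto simp: small_finite[OF universe])
  have pX: "p True \<in> hom C E X" and eqs: "u \<cdot> p True = p False" "v \<cdot> p True = p False"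
    using p[of True] eq[of True] eq[of False] by auto
  show thesis
  proof (rule that)
    show "is_mono C (p True)"
    proof (rule is_monoI[OF pX])
      fix Z k l
      assume kl: "k \<in> hom C Z E" "l \<in> hom C Z E" "p True \<cdot> k = p True \<cdot> l"
      then have "p False \<cdot> k = p False \<cdot> l"
        using cmp_assoc[OF kl(1) pX u] cmp_assoc[OF kl(2) pX u] eqs(1) by simp
      then have "p b \<cdot> k = p b \<cdot> l" for b
        using kl(3) by (cases b) auto
      then show "k = l"
        using uniq kl by blast
    qed
    show "\<exists>k \<in> hom C Z E. p True \<cdot> k = w" if w: "w \<in> hom C Z X" "u \<cdot> w = v \<cdot> w" for Z w
    proof -
      have "\<exists>k \<in> hom C Z E. \<forall>b \<in> UNIV. p b \<cdot> k = (if b then w else u \<cdot> w)"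
        by (rule ex) (use w hom_Ob(1)[OF w(1)] cmp_in_hom[OF w(1) u] in auto)
      then show ?thesis
        by (metis UNIV_I)
    qed
  qed (use pX eqs in auto)
qed

text \<open>The vertex \<open>None\<close> carries the common codomain \<open>P\<close>, and
  \<open>Some k\<close> carries \<open>M k\<close>. Giving \<open>P\<close> its own vertex and leg
  \<open>n\<close> makes the limit meaningful for empty \<open>K\<close> too, where \<open>N\<close>
  is isomorphic to \<open>P\<close>.\<close>

lemma wide_pullback:
  assumes K: "small \<kappa> K" and P: "P \<in> Ob C" and m: "\<And>k. k \<in> K \<Longrightarrow> m k \<in> hom C (M k) P"
  obtains N n l where "n \<in> hom C N P" "\<And>k. k \<in> K \<Longrightarrow> l k \<in> hom C N (M k)"
    and "\<And>k. k \<in> K \<Longrightarrow> m k \<cdot> l k = n"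
    and "\<And>Z w q. w \<in> hom C Z P \<Longrightarrow> (\<And>k. k \<in> K \<Longrightarrow> q k \<in> hom C Z (M k)) \<Longrightarrow>
           (\<And>k. k \<in> K \<Longrightarrow> m k \<cdot> q k = w) \<Longrightarrow>
           \<exists>u \<in> hom C Z N. n \<cdot> u = w \<and> (\<forall>k \<in> K. l k \<cdot> u = q k)"
    and "\<And>Z u v. u \<in> hom C Z N \<Longrightarrow> v \<in> hom C Z N \<Longrightarrow> n \<cdot> u = n \<cdot> v \<Longrightarrow>
           (\<And>k. k \<in> K \<Longrightarrow> l k \<cdot> u = l k \<cdot> v) \<Longrightarrow> u = v"
proof -
  let ?V = "insert None (Some ` K)" and ?A = "case_option P M"
  have V: "small \<kappa> ?V"
    using small_Un[OF universe small_finite[OF universe] small_image[OF K], of "{None}" Some] by simp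
  obtain N p where "N \<in> Ob C" and p: "\<And>x. x \<in> ?V \<Longrightarrow> p x \<in> hom C N (?A x)"
    and eq: "\<And>k. k \<in> K \<Longrightarrow> m k \<cdot> p (Some k) = p None"
    and ex: "\<And>Z q. Z \<in> Ob C \<Longrightarrow> (\<And>x. x \<in> ?V \<Longrightarrow> q x \<in> hom C Z (?A x)) \<Longrightarrow>
           (\<And>k. k \<in> K \<Longrightarrow> m k \<cdot> q (Some k) = q None) \<Longrightarrow>
           \<exists>u \<in> hom C Z N. \<forall>x \<in> ?V. p x \<cdot> u = q x"
    and uniq: "\<And>Z u v. u \<in> hom C Z N \<Longrightarrow> v \<in> hom C Z N \<Longrightarrow>
           (\<And>x. x \<in> ?V \<Longrightarrow> p x \<cdot> u = p x \<cdot> v) \<Longrightarrow> u = v"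
    using V K P m hom_Ob(1)[OF m]
    by (rule_tac V = ?V and E = K and A = ?A and f = m and s = Some and t = "\<lambda>_. None"
        in bipartite_limit) auto
  show thesis
  proof (rule that)
    show "p None \<in> hom C N P" "\<And>k. k \<in> K \<Longrightarrow> p (Some k) \<in> hom C N (M k)"
      using p[of None] p[of "Some k" for k] by auto
    show "\<And>k. k \<in> K \<Longrightarrow> m k \<cdot> p (Some k) = p None"
      by (rule eq)
    show "\<exists>u \<in> hom C Z N. p None \<cdot> u = w \<and> (\<forall>k \<in> K. p (Some k) \<cdot> u = q k)"
      if "w \<in> hom C Z P" "\<And>k. k \<in> K \<Longrightarrow> q k \<in> hom C Z (M k)"
        "\<And>k. k \<in> K \<Longrightarrow> m k \<cdot> q k = w" for Z w q
    proof -
      have "\<exists>u \<in> hom C Z N. \<forall>x \<in> ?V. p x \<cdot> u = case_option w q x"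
        by (rule ex) (use hom_Ob(1)[OF that(1)] that in auto)
      then show ?thesis
        by simp
    qed
    show "u = v" if "u \<in> hom C Z N" "v \<in> hom C Z N" "p None \<cdot> u = p None \<cdot> v"
      "\<And>k. k \<in> K \<Longrightarrow> p (Some k) \<cdot> u = p (Some k) \<cdot> v" for Z u v
      using uniq[OF that(1,2)] that(3,4) by auto
  qed
qed

text \<open>Since each \<open>m k\<close> is monic, the legs \<open>l k\<close> are determined by
  \<open>n\<close>. Hence \<open>n\<close> is monic by itself, and lifts of an arrow through the
  single \<open>m k\<close> need no further compatibility to give a lift through
  \<open>n\<close>.\<close>

lemma intersection:
  assumes K: "small \<kappa> K" and P: "P \<in> Ob C" and m: "\<And>k. k \<in> K \<Longrightarrow> m k \<in> hom C (M k) P"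
    and mono: "\<And>k. k \<in> K \<Longrightarrow> is_mono C (m k)"
  obtains N n where "n \<in> hom C N P" "is_mono C n"
    and "\<And>k. k \<in> K \<Longrightarrow> \<exists>l \<in> hom C N (M k). m k \<cdot> l = n"
    and "\<And>Z w. w \<in> hom C Z P \<Longrightarrow> (\<And>k. k \<in> K \<Longrightarrow> \<exists>l \<in> hom C Z (M k). m k \<cdot> l = w) \<Longrightarrow>
           \<exists>u \<in> hom C Z N. n \<cdot> u = w"
proof -
  obtain N n l where n: "n \<in> hom C N P" and l: "\<And>k. k \<in> K \<Longrightarrow> l k \<in> hom C N (M k)"
    and eq: "\<And>k. k \<in> K \<Longrightarrow> m k \<cdot> l k = n"
    and ex: "\<And>Z w q. w \<in> hom C Z P \<Longrightarrow> (\<And>k. k \<in> K \<Longrightarrow> q k \<in> hom C Z (M k)) \<Longrightarrow>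
           (\<And>k. k \<in> K \<Longrightarrow> m k \<cdot> q k = w) \<Longrightarrow>
           \<exists>u \<in> hom C Z N. n \<cdot> u = w \<and> (\<forall>k \<in> K. l k \<cdot> u = q k)"
    and uniq: "\<And>Z u v. u \<in> hom C Z N \<Longrightarrow> v \<in> hom C Z N \<Longrightarrow> n \<cdot> u = n \<cdot> v \<Longrightarrow>
           (\<And>k. k \<in> K \<Longrightarrow> l k \<cdot> u = l k \<cdot> v) \<Longrightarrow> u = v"
    by (rule wide_pullback[where M = M, OF K P m]) auto
  show thesis
  proof (rule that)
    show "is_mono C n"
    proof (rule is_monoI[OF n])
      fix Z u v
      assume uv: "u \<in> hom C Z N" "v \<in> hom C Z N" "n \<cdot> u = n \<cdot> v"
      have "l k \<cdot> u = l k \<cdot> v" if k: "k \<in> K" for k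
      proof (rule mono_cancel[OF mono[OF k] m[OF k]])
        show "m k \<cdot> (l k \<cdot> u) = m k \<cdot> (l k \<cdot> v)"
          using cmp_assoc[OF uv(1) l[OF k] m[OF k]] cmp_assoc[OF uv(2) l[OF k] m[OF k]]
            eq[OF k] uv(3) by simp
      qed (use uv l[OF k] cmp_in_hom in blast)+
      then show "u = v"
        using uniq uv by blast
    qed
    show "\<exists>u \<in> hom C Z N. n \<cdot> u = w"
      if w: "w \<in> hom C Z P" and q: "\<And>k. k \<in> K \<Longrightarrow> \<exists>l \<in> hom C Z (M k). m k \<cdot> l = w" for Z w
    proof -
      obtain q' where "\<And>k. k \<in> K \<Longrightarrow> q' k \<in> hom C Z (M k) \<and> m k \<cdot> q' k = w"
        using q by metis
      then show ?thesis
        using ex[of w Z q'] w by blast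
    qed
  qed (use n l eq in blast)+
qed

text \<open>A wide pullback over two indices, \<open>True\<close> for \<open>g\<close> and
  \<open>False\<close> for \<open>f\<close>. Arrows that agree after the leg to \<open>P\<close>
  agree after \<open>n\<close>, which also factors through \<open>f\<close>; cancelling the mono
  \<open>f\<close> gives agreement after the leg to \<open>A\<close>.\<close>

lemma pullback_mono:
  assumes f: "f \<in> hom C A B" "is_mono C f" and g: "g \<in> hom C P B"
  obtains N n h where "n \<in> hom C N P" "is_mono C n" "h \<in> hom C N A" "g \<cdot> n = f \<cdot> h"
    and "\<And>Z w k. w \<in> hom C Z P \<Longrightarrow> k \<in> hom C Z A \<Longrightarrow> g \<cdot> w = f \<cdot> k \<Longrightarrow> \<exists>u \<in> hom C Z N. n \<cdot> u = w"
proof -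
  let ?m = "\<lambda>b. if b then g else f" and ?M = "\<lambda>b. if b then P else A"
  have m: "?m b \<in> hom C (?M b) B" for b
    using f g by simp
  obtain N n l where n: "n \<in> hom C N B" and l: "\<And>b. b \<in> UNIV \<Longrightarrow> l b \<in> hom C N (?M b)"
    and eq: "\<And>b. b \<in> UNIV \<Longrightarrow> ?m b \<cdot> l b = n"
    and ex: "\<And>Z w q. w \<in> hom C Z B \<Longrightarrow> (\<And>b. b \<in> UNIV \<Longrightarrow> q b \<in> hom C Z (?M b)) \<Longrightarrow>
           (\<And>b. b \<in> UNIV \<Longrightarrow> ?m b \<cdot> q b = w) \<Longrightarrow>
           \<exists>u \<in> hom C Z N. n \<cdot> u = w \<and> (\<forall>b \<in> UNIV. l b \<cdot> u = q b)"
    and uniq: "\<And>Z u v. u \<in> hom C Z N \<Longrightarrow> v \<in> hom C Z N \<Longrightarrow> n \<cdot> u = n \<cdot> v \<Longrightarrow>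
           (\<And>b. b \<in> UNIV \<Longrightarrow> l b \<cdot> u = l b \<cdot> v) \<Longrightarrow> u = v"
    by (rule wide_pullback[where M = ?M and m = ?m and K = UNIV,
          OF small_finite[OF universe finite] hom_Ob(2)[OF g] m]) auto
  have lP: "l True \<in> hom C N P" and lA: "l False \<in> hom C N A"
    and eqs: "g \<cdot> l True = n" "f \<cdot> l False = n"
    using l[of True] l[of False] eq[of True] eq[of False] by auto
  show thesis
  proof (rule that)
    show "is_mono C (l True)"
    proof (rule is_monoI[OF lP])
      fix Z u v
      assume uv: "u \<in> hom C Z N" "v \<in> hom C Z N" "l True \<cdot> u = l True \<cdot> v"
      have n_uv: "n \<cdot> u = n \<cdot> v"
        using cmp_assoc[OF uv(1) lP g] cmp_assoc[OF uv(2) lP g] eqs(1) uv(3) by simp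
      have "l False \<cdot> u = l False \<cdot> v"
        using mono_cancel[OF f(2,1) cmp_in_hom[OF uv(1) lA] cmp_in_hom[OF uv(2) lA]]
          cmp_assoc[OF uv(1) lA f(1)] cmp_assoc[OF uv(2) lA f(1)] eqs(2) n_uv by simp
      then have "l b \<cdot> u = l b \<cdot> v" for b
        using uv(3) by (cases b) auto
      then show "u = v"
        using uniq[OF uv(1,2) n_uv] by blast
    qed
    show "\<exists>u \<in> hom C Z N. l True \<cdot> u = w"
      if w: "w \<in> hom C Z P" "k \<in> hom C Z A" "g \<cdot> w = f \<cdot> k" for Z w k
    proof -
      have "\<exists>u \<in> hom C Z N. n \<cdot> u = g \<cdot> w \<and> (\<forall>b \<in> UNIV. l b \<cdot> u = (if b then w else k))"
        by (rule ex) (use w cmp_in_hom[OF w(1) g] in auto)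
      then show ?thesis
        by (metis UNIV_I)
    qed
  qed (use lP lA eqs in auto)
qed

end


subsection \<open>The special adjoint functor theorem for the diagonal functor\<close>

text \<open>
  For monic \<open>m\<close>, lifts of the single components \<open>p i\<close> automatically form a cocone.
\<close>

definition lifts :: "('i, 'j, 'l) cat_scheme \<Rightarrow> ('o, 'a, 'm) cat_scheme \<Rightarrow>
    ('i, 'j, 'o, 'a) func \<Rightarrow> ('i \<Rightarrow> 'a) \<Rightarrow> 'a \<Rightarrow> bool" where
  "lifts J C d p m \<longleftrightarrow> (\<forall>i \<in> Ob J. \<exists>l \<in> hom C (Fo d i) (src C m). m \<cdot>\<^bsub>C\<^esub> l = p i)"

context small_complete_category
begin

text \<open>Well-poweredness leaves only a small set of isomorphism classes of subobjects to
  intersect. The intersection is again a lifting subobject, because each \<open>p i\<close> factors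
  through every member of the family.\<close>

lemma least_lifting_subobject:
  assumes wp: "well_powered \<kappa> C" and P: "P \<in> Ob C"
    and p: "\<And>i. i \<in> Ob J \<Longrightarrow> p i \<in> hom C (Fo d i) P"
  obtains M m where "m \<in> hom C M P" "is_mono C m" "lifts J C d p m"
    and "\<And>N n. n \<in> hom C N P \<Longrightarrow> is_mono C n \<Longrightarrow> lifts J C d p n \<Longrightarrow> \<exists>l \<in> hom C M N. n \<cdot> l = m"
proof -
  define K where "K = {c \<in> monos_into C P // subobject_iso C P. \<exists>m \<in> c. lifts J C d p m}"
  \<comment> \<open>The representative is chosen among the lifting members of the class, which
    avoids proving that lifting is invariant under isomorphism of subobjects.\<close>
  define r where "r c = (SOME m. m \<in> c \<and> lifts J C d p m)" for c
  have K: "small \<kappa> K"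
    using wp P small_subset[of \<kappa> _ K] unfolding well_powered_def K_def by blast
  have r: "r c \<in> c \<and> lifts J C d p (r c)" if "c \<in> K" for c
    using that someI_ex[of "\<lambda>m. m \<in> c \<and> lifts J C d p m"] unfolding r_def K_def by blast
  then have r_mono: "r c \<in> hom C (src C (r c)) P" "is_mono C (r c)" if "c \<in> K" for c
    using that unfolding K_def quotient_def subobject_iso_def monos_into_def is_mono_def hom_def
    by auto
  obtain M m where m: "m \<in> hom C M P" "is_mono C m"
    and below: "\<And>c. c \<in> K \<Longrightarrow> \<exists>l \<in> hom C M (src C (r c)). r c \<cdot> l = m"
    and glb: "\<And>Z w. w \<in> hom C Z P \<Longrightarrow> (\<And>c. c \<in> K \<Longrightarrow> \<exists>l \<in> hom C Z (src C (r c)). r c \<cdot> l = w) \<Longrightarrow>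
           \<exists>u \<in> hom C Z M. m \<cdot> u = w"
    by (rule intersection[OF K P r_mono]) auto
  show thesis
  proof (rule that[OF m])
    have "src C m = M"
      using m(1) unfolding hom_def by simp
    then show "lifts J C d p m"
      using glb[OF p] r unfolding lifts_def by blast
    fix N n
    assume n: "n \<in> hom C N P" "is_mono C n" "lifts J C d p n"
    \<comment> \<open>An arbitrary lifting \<open>n\<close> need not be the chosen representative of
      its class, but \<open>m\<close> factors through the representative and the representative
      through \<open>n\<close>.\<close>
    let ?c = "subobject_iso C P `` {n}"
    have "?c \<in> K"
      using n subobject_iso_refl[OF n(2,1)] unfolding K_def monos_into_def
      by (auto simp: hom_def intro!: quotientI)
    then obtain l where l: "l \<in> hom C M (src C (r ?c))" "r ?c \<cdot> l = m"
      using below by blast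
    have "(n, r ?c) \<in> subobject_iso C P"
      using r[OF \<open>?c \<in> K\<close>] by simp
    then obtain g where g: "g \<in> hom C (src C (r ?c)) N" "n \<cdot> g = r ?c"
      using subobject_iso_factor[OF _ n(1)] by blast
    show "\<exists>l \<in> hom C M N. n \<cdot> l = m"
      using cmp_assoc[OF l(1) g(1) n(1)] cmp_in_hom[OF l(1) g(1)] l(2) g(2) by auto
  qed
qed

theorem small_colimit:
  fixes J :: "('i, 'j, 'n) cat_scheme" and S :: "'s set"
  assumes J: "small_category \<kappa> J" and d: "is_functor J C d"
    and ls: "locally_small \<kappa> C" and wp: "well_powered \<kappa> C"
    and S: "small \<kappa> S" and G: "cogenerating_family C S G"
  obtains M p where "is_colimit J C d M p"
proof -
  have d_Ob: "Fo d i \<in> Ob C" if "i \<in> Ob J" for i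
    using that d unfolding is_functor_def by blast
  have G_Ob: "G s \<in> Ob C" if "s \<in> S" for s
    using that G unfolding cogenerating_family_def by blast
  have d_hom: "Fa d e \<in> hom C (Fo d i) (Fo d j)" if "i \<in> Ob J" "j \<in> Ob J" "e \<in> hom J i j" for i j e
    using that d unfolding is_functor_def by blast
  \<comment> \<open>The index set of the product \<open>P\<close>: a cogenerator together with a
    cocone into it. Taking cocones in \<open>PiE\<close> records only their legs on
    \<open>Ob J\<close>, so local smallness makes \<open>I\<close> small.\<close>
  define I where "I = (SIGMA s : S. {q \<in> PiE (Ob J) (\<lambda>i. hom C (Fo d i) (G s)). is_cocone J C d (G s) q})"
  have "small \<kappa> (SIGMA s : S. PiE (Ob J) (\<lambda>i. hom C (Fo d i) (G s)))"
    using J S ls d_Ob G_Ob unfolding small_category_def locally_small_def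
    by (intro small_Sigma small_PiE universe) auto
  then have I: "small \<kappa> I"
    by (rule small_subset) (auto simp: I_def)
  have I_Ob: "G (fst x) \<in> Ob C" if "x \<in> I" for x
    using that G_Ob unfolding I_def by auto
  obtain P \<pi> where P: "P \<in> Ob C" and \<pi>: "\<And>x. x \<in> I \<Longrightarrow> \<pi> x \<in> hom C P (G (fst x))"
    and P_ex: "\<And>Y q. Y \<in> Ob C \<Longrightarrow> (\<And>x. x \<in> I \<Longrightarrow> q x \<in> hom C Y (G (fst x))) \<Longrightarrow>
           \<exists>u \<in> hom C Y P. \<forall>x \<in> I. \<pi> x \<cdot> u = q x"
    and P_uniq: "\<And>Y u w. u \<in> hom C Y P \<Longrightarrow> w \<in> hom C Y P \<Longrightarrow>
           (\<And>x. x \<in> I \<Longrightarrow> \<pi> x \<cdot> u = \<pi> x \<cdot> w) \<Longrightarrow> u = w"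
    by (rule product[OF I, of "\<lambda>x. G (fst x)", OF I_Ob]) auto
  have I_hom: "snd x i \<in> hom C (Fo d i) (G (fst x))" if "x \<in> I" "i \<in> Ob J" for x i
    using that unfolding I_def by auto
  have I_cocone: "snd x j \<cdot> Fa d e = snd x i"
    if "x \<in> I" "i \<in> Ob J" "j \<in> Ob J" "e \<in> hom J i j" for x i j e
    using that unfolding I_def is_cocone_def by auto
  \<comment> \<open>The component of \<open>p i\<close> at the index \<open>x\<close> is the leg at
    \<open>i\<close> of the cocone \<open>snd x\<close>; thus each cocone into a cogenerator is
    \<open>p\<close> followed by a projection.\<close>
  have "\<exists>u \<in> hom C (Fo d i) P. \<forall>x \<in> I. \<pi> x \<cdot> u = snd x i" if "i \<in> Ob J" for i
    using P_ex[OF d_Ob[OF that], of "\<lambda>x. snd x i"] I_hom that by blast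
  then obtain p where p: "\<And>i. i \<in> Ob J \<Longrightarrow> p i \<in> hom C (Fo d i) P"
    and \<pi>_p: "\<And>i x. i \<in> Ob J \<Longrightarrow> x \<in> I \<Longrightarrow> \<pi> x \<cdot> p i = snd x i"
    by metis
  have p_cocone: "p j \<cdot> Fa d e = p i" if e: "i \<in> Ob J" "j \<in> Ob J" "e \<in> hom J i j" for i j e
  proof (rule P_uniq[OF cmp_in_hom[OF d_hom[OF e] p[OF e(2)]] p[OF e(1)]])
    fix x
    assume x: "x \<in> I"
    show "\<pi> x \<cdot> (p j \<cdot> Fa d e) = \<pi> x \<cdot> p i"
      using cmp_assoc[OF d_hom[OF e] p[OF e(2)] \<pi>[OF x]] \<pi>_p[OF e(1) x] \<pi>_p[OF e(2) x]
        I_cocone[OF x e] by simp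
  qed
  obtain M m where m: "m \<in> hom C M P" "is_mono C m" "lifts J C d p m"
    and least: "\<And>N n. n \<in> hom C N P \<Longrightarrow> is_mono C n \<Longrightarrow> lifts J C d p n \<Longrightarrow>
        \<exists>l \<in> hom C M N. n \<cdot> l = m"
    by (rule least_lifting_subobject[OF wp P p]) auto
  have src: "src C f = X" if "f \<in> hom C X Y" for f X Y
    using that unfolding hom_def by simp
  obtain c where c: "\<And>i. i \<in> Ob J \<Longrightarrow> c i \<in> hom C (Fo d i) M"
    and m_c: "\<And>i. i \<in> Ob J \<Longrightarrow> m \<cdot> c i = p i"
    using m(3) unfolding lifts_def src[OF m(1)] by metis
  have c_cocone: "is_cocone J C d M c"
    unfolding is_cocone_def
  proof (intro conjI ballI)
    fix i j e
    assume e: "i \<in> Ob J" "j \<in> Ob J" "e \<in> hom J i j"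
    show "c j \<cdot> Fa d e = c i"
    proof (rule mono_cancel[OF m(2,1) cmp_in_hom[OF d_hom[OF e] c[OF e(2)]] c[OF e(1)]])
      show "m \<cdot> (c j \<cdot> Fa d e) = m \<cdot> c i"
        using cmp_assoc[OF d_hom[OF e] c[OF e(2)] m(1)] m_c e p_cocone[OF e] by simp
    qed
  qed (use c hom_Ob(1)[OF m(1)] in auto)
  have uniq: "u = v"
    if u: "u \<in> hom C M Y" and v: "v \<in> hom C M Y" and eq: "\<And>i. i \<in> Ob J \<Longrightarrow> u \<cdot> c i = v \<cdot> c i" for Y u v
  proof -
    \<comment> \<open>Each \<open>c i\<close> factors through the equalizer, so
      \<open>m \<cdot> e\<close> is a lifting subobject of \<open>P\<close>, and minimality of
      \<open>M\<close> makes \<open>m\<close> factor through it.\<close>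
    obtain E e where e: "e \<in> hom C E M" "is_mono C e" "u \<cdot> e = v \<cdot> e"
      and e_ex: "\<And>Z w. w \<in> hom C Z M \<Longrightarrow> u \<cdot> w = v \<cdot> w \<Longrightarrow> \<exists>k \<in> hom C Z E. e \<cdot> k = w"
      by (rule equalizer[OF u v]) auto
    have me: "m \<cdot> e \<in> hom C E P"
      using cmp_in_hom[OF e(1) m(1)] .
    have "is_mono C (m \<cdot> e)"
    proof (rule is_monoI[OF me])
      fix Z k l
      assume kl: "k \<in> hom C Z E" "l \<in> hom C Z E" "(m \<cdot> e) \<cdot> k = (m \<cdot> e) \<cdot> l"
      then have "e \<cdot> k = e \<cdot> l"
        using mono_cancel[OF m(2,1) cmp_in_hom[OF kl(1) e(1)] cmp_in_hom[OF kl(2) e(1)]]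
          cmp_assoc[OF kl(1) e(1) m(1)] cmp_assoc[OF kl(2) e(1) m(1)] by simp
      then show "k = l"
        using mono_cancel[OF e(2,1)] kl by blast
    qed
    moreover have "lifts J C d p (m \<cdot> e)"
      unfolding lifts_def src[OF me]
    proof
      fix i
      assume i: "i \<in> Ob J"
      obtain k where k: "k \<in> hom C (Fo d i) E" "e \<cdot> k = c i"
        using e_ex[OF c[OF i] eq[OF i]] by blast
      then show "\<exists>k \<in> hom C (Fo d i) E. (m \<cdot> e) \<cdot> k = p i"
        using cmp_assoc[OF k(1) e(1) m(1)] m_c[OF i] by auto
    qed
    ultimately obtain l where l: "l \<in> hom C M E" "(m \<cdot> e) \<cdot> l = m"
      using least[OF me] by blast
    have id: "ident C M \<in> hom C M M"
      using ident_in_hom[OF hom_Ob(1)[OF m(1)]] .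
    \<comment> \<open>Cancelling \<open>m\<close> shows that \<open>e\<close> has the right inverse
      \<open>l\<close>, so \<open>u \<cdot> e = v \<cdot> e\<close> forces
      \<open>u = v\<close>.\<close>
    have "e \<cdot> l = ident C M"
      using mono_cancel[OF m(2,1) cmp_in_hom[OF l(1) e(1)] id]
        cmp_assoc[OF l(1) e(1) m(1)] l(2) cmp_ident_right[OF m(1)] by simp
    then have "u = (u \<cdot> e) \<cdot> l" "v = (v \<cdot> e) \<cdot> l"
      using cmp_assoc[OF l(1) e(1) u] cmp_assoc[OF l(1) e(1) v] cmp_ident_right[OF u]
        cmp_ident_right[OF v] by auto
    then show "u = v"
      using e(3) by simp
  qed
  have ex: "\<exists>u \<in> hom C M Y. \<forall>i \<in> Ob J. u \<cdot> c i = q i" if q: "is_cocone J C d Y q" for Y q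
  proof -
    have Y: "Y \<in> Ob C" and q_hom: "\<And>i. i \<in> Ob J \<Longrightarrow> q i \<in> hom C (Fo d i) Y"
      and q_eq: "\<And>i j e. i \<in> Ob J \<Longrightarrow> j \<in> Ob J \<Longrightarrow> e \<in> hom J i j \<Longrightarrow> q j \<cdot> Fa d e = q i"
      using q unfolding is_cocone_def by blast+
    \<comment> \<open>\<open>Q\<close> will have one factor \<open>G s\<close> for each arrow from
      \<open>Y\<close> to \<open>G s\<close>, and \<open>f\<close> will have that arrow as its
      component there. Joint monicity of these arrows is what makes \<open>f\<close> monic.\<close>
    define H where "H = (SIGMA s : S. hom C Y (G s))"
    have H: "small \<kappa> H"
      unfolding H_def using S ls Y G_Ob
      by (intro small_Sigma universe) (auto simp: locally_small_def)
    have H_hom: "snd y \<in> hom C Y (G (fst y))" and H_Ob: "G (fst y) \<in> Ob C" if "y \<in> H" for y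
      using that G_Ob unfolding H_def by auto
    obtain Q \<rho> where "Q \<in> Ob C" and \<rho>: "\<And>y. y \<in> H \<Longrightarrow> \<rho> y \<in> hom C Q (G (fst y))"
      and Q_ex: "\<And>Z h. Z \<in> Ob C \<Longrightarrow> (\<And>y. y \<in> H \<Longrightarrow> h y \<in> hom C Z (G (fst y))) \<Longrightarrow>
           \<exists>u \<in> hom C Z Q. \<forall>y \<in> H. \<rho> y \<cdot> u = h y"
      and Q_uniq: "\<And>Z u w. u \<in> hom C Z Q \<Longrightarrow> w \<in> hom C Z Q \<Longrightarrow>
           (\<And>y. y \<in> H \<Longrightarrow> \<rho> y \<cdot> u = \<rho> y \<cdot> w) \<Longrightarrow> u = w"
      by (rule product[OF H, of "\<lambda>y. G (fst y)", OF H_Ob]) auto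
    obtain f where f: "f \<in> hom C Y Q" and \<rho>_f: "\<And>y. y \<in> H \<Longrightarrow> \<rho> y \<cdot> f = snd y"
      using Q_ex[OF Y H_hom] by blast
    have f_mono: "is_mono C f"
    proof (rule is_monoI[OF f])
      fix Z u v
      assume uv: "u \<in> hom C Z Y" "v \<in> hom C Z Y" "f \<cdot> u = f \<cdot> v"
      have "h \<cdot> u = h \<cdot> v" if "s \<in> S" "h \<in> hom C Y (G s)" for s h
      proof -
        have y: "(s, h) \<in> H"
          using that unfolding H_def by simp
        show ?thesis
          using cmp_assoc[OF uv(1) f \<rho>[OF y]] cmp_assoc[OF uv(2) f \<rho>[OF y]] \<rho>_f[OF y] uv(3) by simp
      qed
      then show "u = v"
        using G Y hom_Ob(1)[OF uv(1)] uv(1,2) unfolding cogenerating_family_def by blast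
    qed
    \<comment> \<open>Following \<open>q\<close> by the arrow \<open>snd y\<close> gives a cocone
      into a cogenerator, hence an index of \<open>P\<close>. The restriction to \<open>Ob J\<close>
      puts it into \<open>PiE\<close>.\<close>
    define x where "x y = (fst y, \<lambda>i \<in> Ob J. snd y \<cdot> q i)" for y :: "'s \<times> 'a"
    have x: "x y \<in> I" if y: "y \<in> H" for y
    proof -
      have "snd y \<cdot> q i \<in> hom C (Fo d i) (G (fst y))" if "i \<in> Ob J" for i
        using cmp_in_hom[OF q_hom[OF that] H_hom[OF y]] .
      moreover have "(snd y \<cdot> q j) \<cdot> Fa d e = snd y \<cdot> q i"
        if "i \<in> Ob J" "j \<in> Ob J" "e \<in> hom J i j" for i j e
        using cmp_assoc[OF d_hom[OF that] q_hom[OF that(2)] H_hom[OF y]] q_eq[OF that] by simp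
      ultimately show ?thesis
        using y H_Ob[OF y] unfolding I_def x_def H_def is_cocone_def by auto
    qed
    have x_fst: "fst (x y) = fst y" for y
      unfolding x_def by simp
    \<comment> \<open>\<open>g\<close> reindexes projections: its component at \<open>y\<close> is
      the projection of \<open>P\<close> at \<open>x y\<close>. Therefore
      \<open>g \<cdot> p i\<close> and \<open>f \<cdot> q i\<close> both have components
      \<open>snd y \<cdot> q i\<close>.\<close>
    obtain g where g: "g \<in> hom C P Q" and \<rho>_g: "\<And>y. y \<in> H \<Longrightarrow> \<rho> y \<cdot> g = \<pi> (x y)"
      using Q_ex[OF P, of "\<lambda>y. \<pi> (x y)"] \<pi>[OF x] unfolding x_fst by blast
    have g_p: "g \<cdot> p i = f \<cdot> q i" if i: "i \<in> Ob J" for i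
    proof (rule Q_uniq[OF cmp_in_hom[OF p[OF i] g] cmp_in_hom[OF q_hom[OF i] f]])
      fix y
      assume y: "y \<in> H"
      have "\<rho> y \<cdot> (g \<cdot> p i) = snd (x y) i"
        using cmp_assoc[OF p[OF i] g \<rho>[OF y]] \<rho>_g[OF y] \<pi>_p[OF i x[OF y]] by simp
      also have "\<dots> = \<rho> y \<cdot> (f \<cdot> q i)"
        using cmp_assoc[OF q_hom[OF i] f \<rho>[OF y]] \<rho>_f[OF y] i unfolding x_def by simp
      finally show "\<rho> y \<cdot> (g \<cdot> p i) = \<rho> y \<cdot> (f \<cdot> q i)" .
    qed
    \<comment> \<open>By \<open>g_p\<close> each \<open>p i\<close> lifts to the pullback of
      \<open>f\<close> along \<open>g\<close>. Minimality then gives \<open>l\<close> from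
      \<open>M\<close> to \<open>N\<close>, and \<open>h \<cdot> l\<close> is the mediating arrow;
      its equations are checked after the mono \<open>f\<close>.\<close>
    obtain N n h where n: "n \<in> hom C N P" "is_mono C n" and h: "h \<in> hom C N Y" "g \<cdot> n = f \<cdot> h"
      and n_ex: "\<And>Z w k. w \<in> hom C Z P \<Longrightarrow> k \<in> hom C Z Y \<Longrightarrow> g \<cdot> w = f \<cdot> k \<Longrightarrow>
          \<exists>u \<in> hom C Z N. n \<cdot> u = w"
      by (rule pullback_mono[OF f f_mono g]) auto
    have "lifts J C d p n"
      unfolding lifts_def src[OF n(1)] using n_ex[OF p q_hom g_p] by blast
    then obtain l where l: "l \<in> hom C M N" "n \<cdot> l = m"
      using least[OF n] by blast
    have hl: "h \<cdot> l \<in> hom C M Y"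
      using cmp_in_hom[OF l(1) h(1)] .
    have "(h \<cdot> l) \<cdot> c i = q i" if i: "i \<in> Ob J" for i
    proof (rule mono_cancel[OF f_mono f cmp_in_hom[OF c[OF i] hl] q_hom[OF i]])
      have "f \<cdot> ((h \<cdot> l) \<cdot> c i) = (f \<cdot> (h \<cdot> l)) \<cdot> c i"
        using cmp_assoc[OF c[OF i] hl f] by simp
      also have "f \<cdot> (h \<cdot> l) = g \<cdot> m"
        using cmp_assoc[OF l(1) h(1) f] cmp_assoc[OF l(1) n(1) g] h(2) l(2) by simp
      also have "(g \<cdot> m) \<cdot> c i = f \<cdot> q i"
        using cmp_assoc[OF c[OF i] m(1) g] m_c[OF i] g_p[OF i] by simp
      finally show "f \<cdot> ((h \<cdot> l) \<cdot> c i) = f \<cdot> q i" .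
    qed
    then show ?thesis
      using hl by blast
  qed
  have "is_colimit J C d M c"
    unfolding is_colimit_def
  proof (intro conjI allI impI)
    fix Y q
    assume "is_cocone J C d Y q"
    then obtain u where "u \<in> hom C M Y" "\<forall>i \<in> Ob J. u \<cdot> c i = q i"
      using ex by blast
    then show "\<exists>!u. u \<in> hom C M Y \<and> (\<forall>i \<in> Ob J. u \<cdot> c i = q i)"
      using uniq by (intro ex1I[of _ u]) auto
  qed (rule c_cocone)
  then show thesis
    using that by blast
qed

end

theorem theorem1:
  fixes \<kappa> :: "'k rel"
    and C :: "('o, 'a) smc"
  assumes "universe_cardinal \<kappa>"
    and "symmetric_monoidal_closed_category C"
    and "locally_small \<kappa> C"
    and "well_powered \<kappa> C"
    and "small_complete \<kappa> C"
    and "has_small_cogenerating_family \<kappa> C"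
  shows "small_cocomplete \<kappa> C"
proof -
  interpret symmetric_monoidal_closed_category C
    by (rule assms(2))
  \<comment> \<open>The interpretation above supplies the category axioms; what remains are the
    conditions on \<kappa> and completeness.\<close>
  interpret small_complete_category C \<kappa>
    by unfold_locales (rule assms(1,5))+
  obtain S :: "'k set" and G where "small \<kappa> S" "cogenerating_family C S G"
    using assms(6) unfolding has_small_cogenerating_family_def by blast
  then show ?thesis
    using small_colimit assms(3,4) unfolding small_cocomplete_def by metis
qed

end
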